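(* Let $\mathcal{P}$ be an operad and let $A$ be a $\mathcal{P}$-algebra. Then, for $n\geq 1$, the vector space $\mathcal{M}_n(A)$ of $(n\times n)$-matrices with coefficients in $A$ carries a canonical $\overline{\mathcal{P}}$-algebra structure given by the family of maps $\alpha_m:\overline{\mathcal{P}}_m\to\mathrm{Hom}(\mathcal{M}_n(A)^{\otimes m},\mathcal{M}_n(A))$ defined by $$\alpha_m(\mu)(M^1\otimes\cdots\otimes M^m)_{i,j}:=\sum_{k_1,\dots,k_{m-1}=1}^{n}\alpha_A(\mu)(M^1_{i,k_1},\dots,M^m_{k_{m-1},j}),\qquad \forall\, 1\leq i,j\leq n,\ \forall\, m\geq 0,$$ where $\alpha_A:\mathcal{P}\to\mathrm{End}_A$ is the structure of $\mathcal{P}$-algebra on $A$.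
   Context: Operads are symmetric operads in vector spaces over a field $\mathbf{k}$. For a symmetric operad $\mathcal{P}$, $\overline{\mathcal{P}}$ denotes the nonsymmetric operad obtained by forgetting the symmetric group actions: $\overline{\mathcal{P}}_m=\mathcal{P}(m)$, with the same composition maps. $\mathrm{End}_A$ is the endomorphism operad of $A$. In the formula, the consecutive arguments of $\alpha_A(\mu)$ are $M^1_{i,k_1},M^2_{k_1,k_2},\dots,M^m_{k_{m-1},j}$, where $M_{i,j}\in A$ denotes the $(i,j)$ entry of a matrix $M$. *)

theory Defs
  imports
    "HOL-Library.FuncSet"
    "HOL-Combinatorics.Permutations"
    "Jordan_Normal_Form.Missing_VectorSpace"
    "Jordan_Normal_Form.Matrix"
begin

section \<open>Nonsymmetric and symmetric operads in vector spaces\<close>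

text \<open>
  Operads are presented by partial compositions. For \<open>\<mu>\<close> of arity \<open>m\<close>, \<open>\<nu>\<close> of arity \<open>n\<close> and a
  slot \<open>i < m\<close>, the operation \<open>pcomp P m i n \<mu> \<nu>\<close>, of arity \<open>m + n - 1\<close>, is obtained by plugging
  \<open>\<nu>\<close> into the slot \<open>i\<close> of \<open>\<mu>\<close>. Slots are numbered from \<open>0\<close>. The arities are arguments of
  \<open>pcomp\<close> because the components \<open>ops P m\<close> for different \<open>m\<close> may overlap as sets.
\<close>

record ('k, 'p) ns_operad =
  ops :: "nat \<Rightarrow> ('k, 'p) module"
  pcomp :: "nat \<Rightarrow> nat \<Rightarrow> nat \<Rightarrow> 'p \<Rightarrow> 'p \<Rightarrow> 'p"
  op_id :: 'p

record ('k, 'p) sym_operad = "('k, 'p) ns_operad" +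
  perm_act :: "nat \<Rightarrow> (nat \<Rightarrow> nat) \<Rightarrow> 'p \<Rightarrow> 'p"

locale ns_operad =
  fixes K :: "('k, 'r) ring_scheme" and P :: "('k, 'p, 'x) ns_operad_scheme"
  assumes vectorspace_ops: "vectorspace K (ops P m)"
    and pcomp_linear_left:
      "\<lbrakk>i < m; \<nu> \<in> carrier (ops P n)\<rbrakk> \<Longrightarrow>
        (\<lambda>\<mu>. pcomp P m i n \<mu> \<nu>) \<in> LinearCombinations.module_hom K (ops P m) (ops P (m + n - 1))"
    and pcomp_linear_right:
      "\<lbrakk>i < m; \<mu> \<in> carrier (ops P m)\<rbrakk> \<Longrightarrow>
        (\<lambda>\<nu>. pcomp P m i n \<mu> \<nu>) \<in> LinearCombinations.module_hom K (ops P n) (ops P (m + n - 1))"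
    and op_id_closed: "op_id P \<in> carrier (ops P 1)"
    and op_id_left:
      "\<nu> \<in> carrier (ops P n) \<Longrightarrow> pcomp P 1 0 n (op_id P) \<nu> = \<nu>"
    and op_id_right:
      "\<lbrakk>i < m; \<mu> \<in> carrier (ops P m)\<rbrakk> \<Longrightarrow> pcomp P m i 1 \<mu> (op_id P) = \<mu>"
    and pcomp_sequential:
      "\<lbrakk>i < l; j < m; \<kappa> \<in> carrier (ops P l); \<mu> \<in> carrier (ops P m); \<nu> \<in> carrier (ops P n)\<rbrakk> \<Longrightarrow>
        pcomp P (l + m - 1) (i + j) n (pcomp P l i m \<kappa> \<mu>) \<nu> =
        pcomp P l i (m + n - 1) \<kappa> (pcomp P m j n \<mu> \<nu>)"
    and pcomp_parallel:
      "\<lbrakk>i < j; j < l; \<kappa> \<in> carrier (ops P l); \<mu> \<in> carrier (ops P m); \<nu> \<in> carrier (ops P n)\<rbrakk> \<Longrightarrow>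
        pcomp P (l + m - 1) (j + m - 1) n (pcomp P l i m \<kappa> \<mu>) \<nu> =
        pcomp P (l + n - 1) i m (pcomp P l j n \<kappa> \<nu>) \<mu>"

text \<open>
  A permutation \<open>\<tau>\<close> of the inputs of \<open>\<nu>\<close>, resp. \<open>\<sigma>\<close> of the inputs of \<open>\<mu>\<close>, induces a permutation
  of the inputs of a partial composition. The first one acts as \<open>\<tau>\<close> inside the block
  \<open>{i..<i + n}\<close>. The second one moves this block to \<open>{\<sigma> i..<\<sigma> i + n}\<close> preserving the order
  inside it, and acts as \<open>\<sigma>\<close> on the remaining inputs.
\<close>

definition inner_perm :: "nat \<Rightarrow> nat \<Rightarrow> (nat \<Rightarrow> nat) \<Rightarrow> nat \<Rightarrow> nat" where
  "inner_perm i n \<tau> p = (if i \<le> p \<and> p < i + n then i + \<tau> (p - i) else p)"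

definition outer_perm :: "nat \<Rightarrow> nat \<Rightarrow> nat \<Rightarrow> (nat \<Rightarrow> nat) \<Rightarrow> nat \<Rightarrow> nat" where
  "outer_perm m i n \<sigma> p =
    (if m + n \<le> p + 1 then p
     else if i \<le> p \<and> p < i + n then \<sigma> i + (p - i)
     else let q = \<sigma> (if p < i then p else p + 1 - n)
          in if q < \<sigma> i then q else q + n - 1)"

locale sym_operad = ns_operad K P
  for K :: "('k, 'r) ring_scheme" and P :: "('k, 'p, 'x) sym_operad_scheme" +
  assumes act_linear:
      "\<sigma> permutes {..<m} \<Longrightarrow> perm_act P m \<sigma> \<in> LinearCombinations.module_hom K (ops P m) (ops P m)"
    and act_id: "\<mu> \<in> carrier (ops P m) \<Longrightarrow> perm_act P m id \<mu> = \<mu>"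
    and act_comp:
      "\<lbrakk>\<sigma> permutes {..<m}; \<tau> permutes {..<m}; \<mu> \<in> carrier (ops P m)\<rbrakk> \<Longrightarrow>
        perm_act P m (\<sigma> \<circ> \<tau>) \<mu> = perm_act P m \<tau> (perm_act P m \<sigma> \<mu>)"
    and act_inner:
      "\<lbrakk>i < m; \<tau> permutes {..<n}; \<mu> \<in> carrier (ops P m); \<nu> \<in> carrier (ops P n)\<rbrakk> \<Longrightarrow>
        pcomp P m i n \<mu> (perm_act P n \<tau> \<nu>) =
        perm_act P (m + n - 1) (inner_perm i n \<tau>) (pcomp P m i n \<mu> \<nu>)"
    and act_outer:
      "\<lbrakk>i < m; \<sigma> permutes {..<m}; \<mu> \<in> carrier (ops P m); \<nu> \<in> carrier (ops P n)\<rbrakk> \<Longrightarrow>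
        pcomp P m i n (perm_act P m \<sigma> \<mu>) \<nu> =
        perm_act P (m + n - 1) (outer_perm m i n \<sigma>) (pcomp P m (\<sigma> i) n \<mu> \<nu>)"

definition forget_sym :: "('k, 'p) sym_operad \<Rightarrow> ('k, 'p) ns_operad" where
  "forget_sym P = \<lparr>ops = ops P, pcomp = pcomp P, op_id = op_id P\<rparr>"

definition ns_operad_hom ::
  "('k, 'r) ring_scheme \<Rightarrow> ('k, 'p, 'x) ns_operad_scheme \<Rightarrow> ('k, 'q, 'y) ns_operad_scheme
    \<Rightarrow> (nat \<Rightarrow> 'p \<Rightarrow> 'q) set" where
  "ns_operad_hom K P Q = {f.
     (\<forall>m. f m \<in> LinearCombinations.module_hom K (ops P m) (ops Q m)) \<and>
     f 1 (op_id P) = op_id Q \<and>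
     (\<forall>m n. \<forall>i<m. \<forall>\<mu>\<in>carrier (ops P m). \<forall>\<nu>\<in>carrier (ops P n).
        f (m + n - 1) (pcomp P m i n \<mu> \<nu>) = pcomp Q m i n (f m \<mu>) (f n \<nu>))}"

definition sym_operad_hom ::
  "('k, 'r) ring_scheme \<Rightarrow> ('k, 'p, 'x) sym_operad_scheme \<Rightarrow> ('k, 'q, 'y) sym_operad_scheme
    \<Rightarrow> (nat \<Rightarrow> 'p \<Rightarrow> 'q) set" where
  "sym_operad_hom K P Q = {f \<in> ns_operad_hom K P Q.
     \<forall>m \<sigma>. \<sigma> permutes {..<m} \<longrightarrow>
       (\<forall>\<mu>\<in>carrier (ops P m). f m (perm_act P m \<sigma> \<mu>) = perm_act Q m \<sigma> (f m \<mu>))}"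


section \<open>Endomorphism operads and algebras\<close>

definition tuples :: "('k, 'a, 'z) module_scheme \<Rightarrow> nat \<Rightarrow> 'a list set" where
  "tuples V m = {xs. length xs = m \<and> set xs \<subseteq> carrier V}"

text \<open>
  A linear map \<open>V\<^sup>\<otimes>\<^sup>m \<rightarrow> V\<close> is represented by the corresponding multilinear map in \<open>m\<close> arguments,
  a function on lists of length \<open>m\<close> that is \<open>undefined\<close> elsewhere. For \<open>m = 0\<close> this is just the
  choice of an element of \<open>V\<close>, the value at \<open>[]\<close>. The fields \<open>mult\<close> and \<open>one\<close>, which every
  \<open>module\<close> record inherits from \<open>ring\<close>, play no role for vector spaces.
\<close>

definition multilinear_maps ::
  "('k, 'r) ring_scheme \<Rightarrow> ('k, 'a, 'z) module_scheme \<Rightarrow> nat \<Rightarrow> ('a list \<Rightarrow> 'a) set" where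
  "multilinear_maps K V m = {f \<in> tuples V m \<rightarrow>\<^sub>E carrier V.
     \<forall>xs\<in>tuples V m. \<forall>i<m. (\<lambda>x. f (xs[i := x])) \<in> LinearCombinations.module_hom K V V}"

definition multilinear_space ::
  "('k, 'r) ring_scheme \<Rightarrow> ('k, 'a, 'z) module_scheme \<Rightarrow> nat \<Rightarrow> ('k, 'a list \<Rightarrow> 'a) module" where
  "multilinear_space K V m =
     \<lparr>carrier = multilinear_maps K V m,
      monoid.mult = undefined, monoid.one = undefined,
      zero = (\<lambda>xs\<in>tuples V m. \<zero>\<^bsub>V\<^esub>),
      add = (\<lambda>f g. \<lambda>xs\<in>tuples V m. f xs \<oplus>\<^bsub>V\<^esub> g xs),
      smult = (\<lambda>c f. \<lambda>xs\<in>tuples V m. c \<odot>\<^bsub>V\<^esub> f xs)\<rparr>"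

text \<open>
  The right action on multilinear maps is
  \<open>(f \<cdot> \<sigma>)(x\<^sub>0, \<dots>, x\<^sub>m\<^sub>-\<^sub>1) = f (x\<^bsub>\<sigma>\<inverse>(0)\<^esub>, \<dots>, x\<^bsub>\<sigma>\<inverse>(m-1)\<^esub>)\<close>.
\<close>

definition End_operad ::
  "('k, 'r) ring_scheme \<Rightarrow> ('k, 'a, 'z) module_scheme \<Rightarrow> ('k, 'a list \<Rightarrow> 'a) sym_operad" where
  "End_operad K V =
     \<lparr>ops = multilinear_space K V,
      pcomp = (\<lambda>m i n f g. \<lambda>xs\<in>tuples V (m + n - 1).
                f (take i xs @ g (take n (drop i xs)) # drop (i + n) xs)),
      op_id = (\<lambda>xs\<in>tuples V 1. xs ! 0),
      perm_act = (\<lambda>m \<sigma> f. \<lambda>xs\<in>tuples V m. f (map (\<lambda>p. xs ! inv_into UNIV \<sigma> p) [0..<m]))\<rparr>"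

definition operad_algebra ::
  "('k, 'r) ring_scheme \<Rightarrow> ('k, 'p) sym_operad \<Rightarrow> ('k, 'a, 'z) module_scheme
    \<Rightarrow> (nat \<Rightarrow> 'p \<Rightarrow> 'a list \<Rightarrow> 'a) \<Rightarrow> bool" where
  "operad_algebra K P V \<alpha> \<longleftrightarrow>
     sym_operad K P \<and> vectorspace K V \<and> \<alpha> \<in> sym_operad_hom K P (End_operad K V)"

definition ns_operad_algebra ::
  "('k, 'r) ring_scheme \<Rightarrow> ('k, 'p) ns_operad \<Rightarrow> ('k, 'a, 'z) module_scheme
    \<Rightarrow> (nat \<Rightarrow> 'p \<Rightarrow> 'a list \<Rightarrow> 'a) \<Rightarrow> bool" where
  "ns_operad_algebra K Q V \<alpha> \<longleftrightarrow>
     ns_operad K Q \<and> vectorspace K V \<and> \<alpha> \<in> ns_operad_hom K Q (forget_sym (End_operad K V))"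


section \<open>Matrices with coefficients in an algebra\<close>

definition matrix_space :: "nat \<Rightarrow> ('k, 'a, 'z) module_scheme \<Rightarrow> ('k, 'a mat) module" where
  "matrix_space n V =
     \<lparr>carrier = {M \<in> carrier_mat n n. elements_mat M \<subseteq> carrier V},
      monoid.mult = undefined, monoid.one = undefined,
      zero = mat n n (\<lambda>_. \<zero>\<^bsub>V\<^esub>),
      add = (\<lambda>M N. mat n n (\<lambda>ij. M $$ ij \<oplus>\<^bsub>V\<^esub> N $$ ij)),
      smult = (\<lambda>c M. mat n n (\<lambda>ij. c \<odot>\<^bsub>V\<^esub> M $$ ij))\<rparr>"

text \<open>
  The sequences \<open>k\<^sub>0, k\<^sub>1, \<dots>, k\<^sub>m\<close> of matrix indices with \<open>k\<^sub>0 = i\<close> and \<open>k\<^sub>m = j\<close>; matrix indices run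
  over \<open>{..<n}\<close>. For \<open>m \<ge> 1\<close> they amount to a free choice of \<open>k\<^sub>1, \<dots>, k\<^sub>m\<^sub>-\<^sub>1\<close>. For \<open>m = 0\<close> the
  constraint is \<open>i = k\<^sub>0 = j\<close>, so that an operation of arity \<open>0\<close> is sent to the diagonal matrix
  having its value on the diagonal, in the same way as the unit of an associative algebra is
  sent to the identity matrix.
\<close>

definition index_paths :: "nat \<Rightarrow> nat \<Rightarrow> nat \<Rightarrow> nat \<Rightarrow> nat list set" where
  "index_paths n m i j =
     {ks. length ks = m + 1 \<and> set ks \<subseteq> {..<n} \<and> ks ! 0 = i \<and> ks ! m = j}"

lemma index_paths_0: "i < n \<Longrightarrow> index_paths n 0 i j = (if i = j then {[i]} else {})"
  by (auto simp: index_paths_def length_Suc_conv)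

lemma index_paths_Suc:
  assumes "i < n" "j < n"
  shows "index_paths n (Suc m) i j =
    (\<lambda>ks. i # ks @ [j]) ` {ks. length ks = m \<and> set ks \<subseteq> {..<n}}"
proof (intro equalityI subsetI)
  fix ls assume "ls \<in> index_paths n (Suc m) i j"
  then have ls: "length ls = m + 2" "set ls \<subseteq> {..<n}" "ls ! 0 = i" "ls ! Suc m = j"
    by (auto simp: index_paths_def)
  then obtain a ls' where 1: "ls = a # ls'" "length ls' = Suc m"
    by (cases ls) auto
  then obtain ks b where 2: "ls' = ks @ [b]" "length ks = m"
    by (metis length_Suc_conv_rev)
  show "ls \<in> (\<lambda>ks. i # ks @ [j]) ` {ks. length ks = m \<and> set ks \<subseteq> {..<n}}"
    using ls 1 2 by (auto simp: nth_append)
qed (use assms in \<open>auto simp: index_paths_def nth_append\<close>)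

definition matrix_action ::
  "nat \<Rightarrow> ('k, 'a, 'z) module_scheme \<Rightarrow> (nat \<Rightarrow> 'p \<Rightarrow> 'a list \<Rightarrow> 'a)
    \<Rightarrow> nat \<Rightarrow> 'p \<Rightarrow> 'a mat list \<Rightarrow> 'a mat" where
  "matrix_action n V \<alpha> m \<mu> =
     (\<lambda>Ms\<in>tuples (matrix_space n V) m. mat n n (\<lambda>(i, j).
        \<Oplus>\<^bsub>V\<^esub>ks\<in>index_paths n m i j.
          \<alpha> m \<mu> (map (\<lambda>p. (Ms ! p) $$ (ks ! p, ks ! (p + 1))) [0..<m])))"

end

theory Submission
  imports Defs
begin

text \<open>
  A sequence of matrix indices \<open>k\<^sub>0, \<dots>, k\<^bsub>m+l-1\<^esub>\<close> along which \<open>\<mu> \<circ>\<^sub>i \<nu>\<close> is evaluated splits uniquely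
  into a sequence for \<open>\<nu>\<close>, namely \<open>k\<^sub>i, \<dots>, k\<^bsub>i+l\<^esub>\<close>, and the sequence for \<open>\<mu>\<close> that jumps from
  \<open>k\<^sub>i\<close> to \<open>k\<^bsub>i+l\<^esub>\<close>. Hence the sum defining the action of \<open>\<mu> \<circ>\<^sub>i \<nu>\<close> is a double sum, and by
  linearity of \<open>\<alpha>\<^sub>A(\<mu>)\<close> in its slot \<open>i\<close> the inner one is an entry of the matrix produced by \<open>\<nu>\<close>.
  Permuting the arguments would break up the sequences of indices, so only the nonsymmetric
  structure survives. An operation of arity \<open>0\<close> joins two equal indices, whence its
  diagonal matrix.
\<close>

section \<open>Finite sums and the vector space of matrices\<close>

text \<open>This pulls the sum over inner paths out of one slot of a multilinear map. The empty sum
  matters: between two distinct indices there is no path of length 0, and the corresponding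
  off-diagonal entry is zero.\<close>

lemma module_hom_finsum:
  assumes "mod_hom R M N f" "finite I" "g \<in> I \<rightarrow> carrier M"
  shows "f (\<Oplus>\<^bsub>M\<^esub>x\<in>I. g x) = (\<Oplus>\<^bsub>N\<^esub>x\<in>I. f (g x))"
proof -
  interpret mod_hom R M N f by fact
  from assms(2,3) show ?thesis
    by (induction rule: finite_induct) (auto simp: Pi_def M.finsum_closed)
qed

lemma finite_index_paths: "finite (index_paths n m i j)"
  by (rule finite_subset[OF _ finite_lists_length_eq[of "{..<n}" "m + 1"]])
    (auto simp: index_paths_def)

lemma carrier_matrix_space:
  "M \<in> carrier (matrix_space n V) \<longleftrightarrow>
    M \<in> carrier_mat n n \<and> (\<forall>i<n. \<forall>j<n. M $$ (i, j) \<in> carrier V)"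
  by (auto simp: matrix_space_def)

lemma matrix_space_simps:
  "zero (matrix_space n V) = mat n n (\<lambda>_. \<zero>\<^bsub>V\<^esub>)"
  "add (matrix_space n V) = (\<lambda>M N. mat n n (\<lambda>ij. M $$ ij \<oplus>\<^bsub>V\<^esub> N $$ ij))"
  "module.smult (matrix_space n V) = (\<lambda>c M. mat n n (\<lambda>ij. c \<odot>\<^bsub>V\<^esub> M $$ ij))"
  by (simp_all add: matrix_space_def)

lemma vectorspace_matrix_space:
  assumes "vectorspace K V"
  shows "vectorspace K (matrix_space n V)"
proof -
  interpret vectorspace K V by fact
  have "abelian_group (matrix_space n V)"
  proof (rule abelian_groupI)
    fix X assume "X \<in> carrier (matrix_space n V)"
    then have "mat n n (\<lambda>ij. \<ominus>\<^bsub>V\<^esub> X $$ ij) \<in> carrier (matrix_space n V)"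
      "mat n n (\<lambda>ij. \<ominus>\<^bsub>V\<^esub> X $$ ij) \<oplus>\<^bsub>matrix_space n V\<^esub> X = \<zero>\<^bsub>matrix_space n V\<^esub>"
      by (auto simp: carrier_matrix_space matrix_space_simps M.l_neg intro!: eq_matI)
    then show "\<exists>Y\<in>carrier (matrix_space n V). Y \<oplus>\<^bsub>matrix_space n V\<^esub> X = \<zero>\<^bsub>matrix_space n V\<^esub>"
      by blast
  qed (auto simp: carrier_matrix_space matrix_space_simps M.a_ac intro!: eq_matI)
  then have "Module.module K (matrix_space n V)"
    by (intro moduleI)
      (auto simp: carrier_matrix_space matrix_space_simps smult_l_distr smult_r_distr
        smult_assoc1 R.is_cring intro!: eq_matI)
  then show ?thesis
    by (simp add: vectorspace_def field_axioms)
qed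

section \<open>Entries along a path of indices, and multilinearity\<close>

text \<open>The argument list in the summands of \<open>matrix_action\<close>. Its length is read
  off \<open>Ms\<close>, so the two agree when \<open>Ms\<close> has length
  \<open>m\<close>.\<close>

definition path_entries :: "'a mat list \<Rightarrow> nat list \<Rightarrow> 'a list" where
  "path_entries Ms ks = map (\<lambda>p. (Ms ! p) $$ (ks ! p, ks ! (p + 1))) [0..<length Ms]"

lemma length_path_entries [simp]: "length (path_entries Ms ks) = length Ms"
  by (simp add: path_entries_def)

lemma nth_path_entries:
  "p < length Ms \<Longrightarrow> path_entries Ms ks ! p = (Ms ! p) $$ (ks ! p, ks ! (p + 1))"
  by (simp add: path_entries_def)

text \<open>Each matrix contributes exactly one entry, at a place fixed by the path. This reduces
  linearity in one matrix to linearity in one argument of the map on \<open>V\<close>.\<close>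

lemma path_entries_update:
  "p < length Ms \<Longrightarrow>
    path_entries (Ms[p := X]) ks = (path_entries Ms ks)[p := X $$ (ks ! p, ks ! (p + 1))]"
  by (rule nth_equalityI) (auto simp: nth_path_entries nth_list_update)

lemma index_paths_nth_less:
  "\<lbrakk>ks \<in> index_paths n m i j; p \<le> m\<rbrakk> \<Longrightarrow> ks ! p < n"
  by (auto simp: index_paths_def subset_iff)

lemma path_entries_in_tuples:
  assumes "Ms \<in> tuples (matrix_space n V) m" "ks \<in> index_paths n m i j"
  shows "path_entries Ms ks \<in> tuples V m"
proof -
  have "Ms ! p \<in> carrier (matrix_space n V)" if "p < m" for p
    using that assms(1) by (force simp: tuples_def)
  then show ?thesis
    using assms index_paths_nth_less[OF assms(2)]
    by (auto simp: tuples_def path_entries_def carrier_matrix_space)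
qed

lemma matrix_action_closed:
  assumes "abelian_group V" "\<alpha> m \<mu> \<in> tuples V m \<rightarrow> carrier V"
    and Ms: "Ms \<in> tuples (matrix_space n V) m"
  shows "matrix_action n V \<alpha> m \<mu> Ms \<in> carrier (matrix_space n V)"
proof -
  interpret abelian_group V by fact
  show ?thesis
    using path_entries_in_tuples[OF Ms] Ms assms(2)
    by (auto simp: matrix_action_def carrier_matrix_space path_entries_def tuples_def Pi_iff
      intro!: finsum_closed)
qed

lemma index_matrix_action:
  assumes "Ms \<in> tuples (matrix_space n V) m" "i < n" "j < n"
  shows "matrix_action n V \<alpha> m \<mu> Ms $$ (i, j) =
    (\<Oplus>\<^bsub>V\<^esub>ks\<in>index_paths n m i j. \<alpha> m \<mu> (path_entries Ms ks))"
  using assms by (simp add: matrix_action_def path_entries_def tuples_def)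

lemma dim_matrix_action:
  assumes "Ms \<in> tuples (matrix_space n V) m"
  shows "dim_row (matrix_action n V \<alpha> m \<mu> Ms) = n" "dim_col (matrix_action n V \<alpha> m \<mu> Ms) = n"
  using assms by (simp_all add: matrix_action_def)

lemma tuples_update:
  "\<lbrakk>xs \<in> tuples V m; x \<in> carrier V\<rbrakk> \<Longrightarrow> xs[i := x] \<in> tuples V m"
  using set_update_subset_insert[of xs i x] by (auto simp: tuples_def)

lemma multilinear_maps_closed:
  "\<lbrakk>f \<in> multilinear_maps K V m; xs \<in> tuples V m\<rbrakk> \<Longrightarrow> f xs \<in> carrier V"
  by (auto simp: multilinear_maps_def)

text \<open>For a fixed path, the summand is linear in the matrix at position \<open>p\<close>: it
  reads off one entry and feeds it into slot \<open>p\<close> of \<open>\<alpha> m \<mu>\<close>. A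
  finite sum of linear maps is linear.\<close>

lemma matrix_action_multilinear:
  assumes "Module.module K V" and f: "\<alpha> m \<mu> \<in> multilinear_maps K V m"
  shows "matrix_action n V \<alpha> m \<mu> \<in> multilinear_maps K (matrix_space n V) m"
proof -
  interpret Module.module K V by fact
  let ?W = "matrix_space n V" and ?f = "matrix_action n V \<alpha> m \<mu>"
  have fc: "\<alpha> m \<mu> \<in> tuples V m \<rightarrow> carrier V"
    using f by (auto simp: multilinear_maps_def)
  have closed: "?f Ms \<in> carrier ?W" if "Ms \<in> tuples ?W m" for Ms
    by (rule matrix_action_closed[where \<alpha> = \<alpha> and m = m, OF M.abelian_group_axioms fc that])
  have ext: "?f \<in> extensional (tuples ?W m)"
    by (simp add: matrix_action_def)
  have "(\<lambda>X. ?f (Ms[p := X])) \<in> LinearCombinations.module_hom K ?W ?W"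
    if Ms: "Ms \<in> tuples ?W m" and p: "p < m" for Ms p
  proof -
    have len: "length Ms = m" using Ms by (simp add: tuples_def)
    have upd: "Ms[p := X] \<in> tuples ?W m" if "X \<in> carrier ?W" for X
      using tuples_update[OF Ms that] .
    have hom: "(\<lambda>x. \<alpha> m \<mu> ((path_entries Ms ks)[p := x])) \<in> LinearCombinations.module_hom K V V"
      if "ks \<in> index_paths n m i j" for ks i j
      using path_entries_in_tuples[OF Ms that] f p by (auto simp: multilinear_maps_def)
    have val: "\<alpha> m \<mu> ((path_entries Ms ks)[p := x]) \<in> carrier V"
      if "ks \<in> index_paths n m i j" "x \<in> carrier V" for ks i j x
      using LinearCombinations.module_hom_closed[OF hom] that by blast
    have entry: "X $$ (ks ! p, ks ! (p + 1)) \<in> carrier V"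
      if "ks \<in> index_paths n m i j" "X \<in> carrier ?W" for ks i j X
      using that p index_paths_nth_less[OF that(1)] by (auto simp: carrier_matrix_space)
    have index: "?f (Ms[p := X]) $$ (i, j) = (\<Oplus>\<^bsub>V\<^esub>ks\<in>index_paths n m i j.
        \<alpha> m \<mu> ((path_entries Ms ks)[p := X $$ (ks ! p, ks ! (p + 1))]))"
      if "X \<in> carrier ?W" "i < n" "j < n" for X i j
      using that p by (simp add: index_matrix_action upd path_entries_update len)
    note simps = carrier_matrix_space matrix_space_simps
    have add: "?f (Ms[p := X \<oplus>\<^bsub>?W\<^esub> Y]) = ?f (Ms[p := X]) \<oplus>\<^bsub>?W\<^esub> ?f (Ms[p := Y])"
      if XY: "X \<in> carrier ?W" "Y \<in> carrier ?W" for X Y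
    proof (rule eq_matI)
      have XY': "X \<oplus>\<^bsub>?W\<^esub> Y \<in> carrier ?W"
        using XY by (auto simp: simps)
      fix i j
      assume "i < dim_row (?f (Ms[p := X]) \<oplus>\<^bsub>?W\<^esub> ?f (Ms[p := Y]))"
        and "j < dim_col (?f (Ms[p := X]) \<oplus>\<^bsub>?W\<^esub> ?f (Ms[p := Y]))"
      then have ij: "i < n" "j < n" by (auto simp: matrix_space_simps)
      have "?f (Ms[p := X \<oplus>\<^bsub>?W\<^esub> Y]) $$ (i, j) = (\<Oplus>\<^bsub>V\<^esub>ks\<in>index_paths n m i j.
          \<alpha> m \<mu> ((path_entries Ms ks)[p := X $$ (ks ! p, ks ! (p + 1))]) \<oplus>\<^bsub>V\<^esub>
          \<alpha> m \<mu> ((path_entries Ms ks)[p := Y $$ (ks ! p, ks ! (p + 1))]))"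
        unfolding index[OF XY' ij]
      proof (intro M.finsum_cong' refl)
        fix ks assume ks: "ks \<in> index_paths n m i j"
        \<comment> \<open>Entries of a sum of matrices are known only inside the \<open>n\<close> by
          \<open>n\<close> range, where the indices of a path lie.\<close>
        have "(X \<oplus>\<^bsub>?W\<^esub> Y) $$ (ks ! p, ks ! (p + 1)) =
            X $$ (ks ! p, ks ! (p + 1)) \<oplus>\<^bsub>V\<^esub> Y $$ (ks ! p, ks ! (p + 1))"
          using index_paths_nth_less[OF ks] p by (simp add: matrix_space_simps)
        then show "\<alpha> m \<mu> ((path_entries Ms ks)[p := (X \<oplus>\<^bsub>?W\<^esub> Y) $$ (ks ! p, ks ! (p + 1))]) =
            \<alpha> m \<mu> ((path_entries Ms ks)[p := X $$ (ks ! p, ks ! (p + 1))]) \<oplus>\<^bsub>V\<^esub>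
            \<alpha> m \<mu> ((path_entries Ms ks)[p := Y $$ (ks ! p, ks ! (p + 1))])"
          using LinearCombinations.module_hom_add[OF hom[OF ks] entry[OF ks XY(1)] entry[OF ks XY(2)]] by simp
      qed (use val entry XY in auto)
      also have "\<dots> = (?f (Ms[p := X]) \<oplus>\<^bsub>?W\<^esub> ?f (Ms[p := Y])) $$ (i, j)"
        using val entry XY ij
        by (subst M.finsum_addf) (auto simp: matrix_space_simps index)
      finally show "?f (Ms[p := X \<oplus>\<^bsub>?W\<^esub> Y]) $$ (i, j) =
        (?f (Ms[p := X]) \<oplus>\<^bsub>?W\<^esub> ?f (Ms[p := Y])) $$ (i, j)" .
    qed (use upd that in \<open>auto simp: simps dim_matrix_action\<close>)
    have smult: "?f (Ms[p := c \<odot>\<^bsub>?W\<^esub> X]) = c \<odot>\<^bsub>?W\<^esub> ?f (Ms[p := X])"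
      if c: "c \<in> carrier K" and X: "X \<in> carrier ?W" for c X
    proof (rule eq_matI)
      have cX: "c \<odot>\<^bsub>?W\<^esub> X \<in> carrier ?W"
        using c X by (auto simp: simps)
      fix i j
      assume "i < dim_row (c \<odot>\<^bsub>?W\<^esub> ?f (Ms[p := X]))"
        and "j < dim_col (c \<odot>\<^bsub>?W\<^esub> ?f (Ms[p := X]))"
      then have ij: "i < n" "j < n" by (auto simp: matrix_space_simps)
      have "?f (Ms[p := c \<odot>\<^bsub>?W\<^esub> X]) $$ (i, j) = (\<Oplus>\<^bsub>V\<^esub>ks\<in>index_paths n m i j.
          c \<odot>\<^bsub>V\<^esub> \<alpha> m \<mu> ((path_entries Ms ks)[p := X $$ (ks ! p, ks ! (p + 1))]))"
        unfolding index[OF cX ij]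
      proof (intro M.finsum_cong' refl)
        fix ks assume ks: "ks \<in> index_paths n m i j"
        have "(c \<odot>\<^bsub>?W\<^esub> X) $$ (ks ! p, ks ! (p + 1)) = c \<odot>\<^bsub>V\<^esub> X $$ (ks ! p, ks ! (p + 1))"
          using index_paths_nth_less[OF ks] p by (simp add: matrix_space_simps)
        then show "\<alpha> m \<mu> ((path_entries Ms ks)[p := (c \<odot>\<^bsub>?W\<^esub> X) $$ (ks ! p, ks ! (p + 1))]) =
            c \<odot>\<^bsub>V\<^esub> \<alpha> m \<mu> ((path_entries Ms ks)[p := X $$ (ks ! p, ks ! (p + 1))])"
          using LinearCombinations.module_hom_smult[OF hom[OF ks] c entry[OF ks X]] by simp
      qed (use val entry X c in auto)
      also have "\<dots> = (c \<odot>\<^bsub>?W\<^esub> ?f (Ms[p := X])) $$ (i, j)"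
        using val entry X ij c
        by (simp add: matrix_space_simps index Pi_def finsum_smult)
      finally show "?f (Ms[p := c \<odot>\<^bsub>?W\<^esub> X]) $$ (i, j) = (c \<odot>\<^bsub>?W\<^esub> ?f (Ms[p := X])) $$ (i, j)" .
    qed (use upd that in \<open>auto simp: simps dim_matrix_action\<close>)
    show ?thesis
      using add smult closed upd by (auto simp: LinearCombinations.module_hom_def)
  qed
  then show ?thesis
    using closed ext by (auto simp: multilinear_maps_def PiE_def)
qed


section \<open>Splitting and gluing paths of indices\<close>

text \<open>The outer path is recovered from the glued one by deleting the interior vertices of
  \<open>qs\<close>, whose two ends are the vertices \<open>i\<close> and \<open>i + 1\<close> of
  \<open>ps\<close>. This makes gluing injective.\<close>

lemma take_drop_insert:
  assumes "length ps = m + 1" "length qs = l + 1" "i < m"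
    and "qs ! 0 = ps ! i" "qs ! l = ps ! (i + 1)"
  shows "take (i + 1) (take i ps @ qs @ drop (i + 2) ps) @
    drop (i + l) (take i ps @ qs @ drop (i + 2) ps) = ps"
proof -
  obtain us x y vs where ps: "ps = us @ x # y # vs" "length us = i"
    using assms(1,3) id_take_nth_drop[of i ps] Cons_nth_drop_Suc[of "Suc i" ps]
    by (metis Suc_eq_plus1 Suc_less_eq length_take less_SucI min.absorb4)
  show ?thesis
  proof (cases l)
    case 0
    \<comment> \<open>Here \<open>qs\<close> is a single vertex, equal to both vertices of
      \<open>ps\<close> next to the slot. The two pieces overlap in it, which restores the repeated
      vertex.\<close>
    then show ?thesis
      using assms(2,4,5) ps by (auto simp: length_Suc_conv nth_append)
  next
    case (Suc l')
    then obtain x' ws y' where qs: "qs = x' # ws @ [y']" "length ws = l'"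
      using assms(2) by (metis Suc_eq_plus1 length_Suc_conv length_Suc_conv_rev)
    then have "x' = x" "y' = y"
      using assms(4,5) ps Suc by (auto simp: nth_append)
    with qs show ?thesis using ps Suc by simp
  qed
qed

text \<open>A path has one vertex more than it has steps, so the glued paths have
  \<open>m + l\<close> vertices. Since \<open>i < m\<close> forces \<open>m\<close> to be positive,
  the subtraction is not truncated, even for \<open>l = 0\<close>.\<close>

lemma index_paths_insert:
  assumes "i < m"
  shows "index_paths n (m + l - 1) a b = (\<Union>ps\<in>index_paths n m a b.
    (\<lambda>qs. take i ps @ qs @ drop (i + 2) ps) ` index_paths n l (ps ! i) (ps ! (i + 1)))"
    (is "?L = ?R")
proof (intro equalityI subsetI)
  fix ks assume ks: "ks \<in> ?L"
  then have len: "length ks = m + l" and sub: "set ks \<subseteq> {..<n}"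
    and ends: "ks ! 0 = a" "ks ! (m + l - 1) = b"
    using assms by (auto simp: index_paths_def)
  \<comment> \<open>The inner path is the window of \<open>l + 1\<close> vertices starting at
    \<open>i\<close>; the outer path jumps from its first vertex to its last.\<close>
  let ?ps = "take (i + 1) ks @ drop (i + l) ks" and ?qs = "take (l + 1) (drop i ks)"
  have "?ps \<in> index_paths n m a b"
    using len sub ends assms set_take_subset[of "i + 1" ks] set_drop_subset[of "i + l" ks]
    by (auto simp: index_paths_def nth_append min_def)
      (rule arg_cong[of _ _ "(!) ks"]; linarith)+
  moreover have "?qs \<in> index_paths n l (?ps ! i) (?ps ! (i + 1))"
    using len sub assms set_take_subset[of "l + 1" "drop i ks"] set_drop_subset[of i ks]
    by (auto simp: index_paths_def nth_append min_def)
  moreover have "ks = take i ?ps @ ?qs @ drop (i + 2) ?ps"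
    using len assms by (intro nth_equalityI) (auto simp: nth_append min_def)
  ultimately show "ks \<in> ?R" by blast
next
  fix ks assume "ks \<in> ?R"
  then obtain ps qs where ps: "ps \<in> index_paths n m a b"
    and qs: "qs \<in> index_paths n l (ps ! i) (ps ! (i + 1))"
    and ks: "ks = take i ps @ qs @ drop (i + 2) ps" by blast
  obtain d where d: "m = Suc (i + d)"
    using assms less_imp_Suc_add by blast
  have "set ks \<subseteq> {..<n}"
    using ps qs ks set_take_subset[of i ps] set_drop_subset[of "i + 2" ps]
    by (auto simp: index_paths_def)
  \<comment> \<open>The number \<open>d\<close> counts the slots after \<open>i\<close>. The first
    vertex of \<open>ks\<close> comes from \<open>qs\<close> if \<open>i = 0\<close>, and the last
    one if \<open>d = 0\<close>; otherwise they come from \<open>ps\<close>.\<close>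
  then show "ks \<in> ?L"
    using ps qs ks d by (cases d; cases i) (auto simp: index_paths_def nth_append)
qed

text \<open>This compares steps instead of vertices: the glued path takes the \<open>l\<close> steps
  of \<open>qs\<close> in place of step \<open>i\<close> of \<open>ps\<close> and shares all others
  with \<open>ps\<close>. The matrix \<open>B\<close> is arbitrary because its entry is overwritten
  by \<open>x\<close>.\<close>

lemma path_entries_insert:
  assumes "length Ms = m + l - 1" "i < m"
    and "ps \<in> index_paths n m a b" "qs \<in> index_paths n l (ps ! i) (ps ! (i + 1))"
  defines "ks \<equiv> take i ps @ qs @ drop (i + 2) ps"
  shows "path_entries (take l (drop i Ms)) qs = take l (drop i (path_entries Ms ks))" (is ?inner)
    and "(path_entries (take i Ms @ B # drop (i + l) Ms) ps)[i := x] =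
      take i (path_entries Ms ks) @ x # drop (i + l) (path_entries Ms ks)" (is ?outer)
proof -
  have *: "length ps = m + 1" "length qs = l + 1" "qs ! 0 = ps ! i" "qs ! l = ps ! (i + 1)"
    using assms by (auto simp: index_paths_def)
  show ?inner
    using * assms(1,2) by (intro nth_equalityI) (auto simp: ks_def nth_path_entries nth_append)
  show ?outer
  proof (rule nth_equalityI)
    fix p assume "p < length ((path_entries (take i Ms @ B # drop (i + l) Ms) ps)[i := x])"
    then have p: "p < m" using assms(1,2) by simp
    \<comment> \<open>The step just before the slot is a case of its own, since it ends at the first
      vertex of \<open>qs\<close>. Likewise the step just after the slot starts at the last vertex
      of \<open>qs\<close>.\<close>
    consider "Suc p < i" | "Suc p = i" | "p = i" | d where "p = Suc i + d"
      by (metis Suc_lessI less_imp_Suc_add linorder_neqE_nat add_Suc)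
    then show "(path_entries (take i Ms @ B # drop (i + l) Ms) ps)[i := x] ! p =
        (take i (path_entries Ms ks) @ x # drop (i + l) (path_entries Ms ks)) ! p"
      using * assms(1,2) p
      by cases (auto simp: ks_def nth_path_entries nth_append)
  qed (use assms(1,2) in auto)
qed

text \<open>The glued paths fall into disjoint classes according to their outer path, and within a
  class they are parametrized injectively by the inner path.\<close>

lemma finsum_index_paths_insert:
  assumes "abelian_monoid V" "i < m" "g \<in> index_paths n (m + l - 1) a b \<rightarrow> carrier V"
  shows "(\<Oplus>\<^bsub>V\<^esub>ks\<in>index_paths n (m + l - 1) a b. g ks) =
    (\<Oplus>\<^bsub>V\<^esub>ps\<in>index_paths n m a b. \<Oplus>\<^bsub>V\<^esub>qs\<in>index_paths n l (ps ! i) (ps ! (i + 1)).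
      g (take i ps @ qs @ drop (i + 2) ps))"
proof -
  interpret abelian_monoid V by fact
  define glue where "glue ps qs = take i ps @ qs @ drop (i + 2) ps" for ps qs :: "nat list"
  define Q where "Q ps = index_paths n l (ps ! i) (ps ! (i + 1))" for ps
  have split: "index_paths n (m + l - 1) a b = (\<Union>ps\<in>index_paths n m a b. glue ps ` Q ps)"
    unfolding glue_def Q_def using index_paths_insert[OF assms(2)] .
  have recover: "take (i + 1) (glue ps qs) @ drop (i + l) (glue ps qs) = ps"
    if "ps \<in> index_paths n m a b" "qs \<in> Q ps" for ps qs
    unfolding glue_def using that assms(2)
    by (intro take_drop_insert[of _ m]) (auto simp: Q_def index_paths_def)
  have inj: "inj_on (glue ps) (Q ps)" for ps
    by (auto simp: inj_on_def glue_def)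
  have val: "g (glue ps qs) \<in> carrier V" if "ps \<in> index_paths n m a b" "qs \<in> Q ps" for ps qs
    using assms(3) that unfolding split by blast
  have "(\<Oplus>\<^bsub>V\<^esub>ks\<in>index_paths n (m + l - 1) a b. g ks) =
      (\<Oplus>\<^bsub>V\<^esub>ps\<in>index_paths n m a b. \<Oplus>\<^bsub>V\<^esub>ks\<in>glue ps ` Q ps. g ks)"
    unfolding split
  proof (rule add.finprod_UN_disjoint)
    show "pairwise (\<lambda>ps ps'. disjnt (glue ps ` Q ps) (glue ps' ` Q ps')) (index_paths n m a b)"
      \<comment> \<open>A path in two classes would yield both outer paths by the same
        recipe.\<close>
      unfolding pairwise_def disjnt_iff using recover by (metis imageE)
  qed (use val in \<open>auto simp: finite_index_paths Q_def\<close>)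
  also have "\<dots> = (\<Oplus>\<^bsub>V\<^esub>ps\<in>index_paths n m a b. \<Oplus>\<^bsub>V\<^esub>qs\<in>Q ps. g (glue ps qs))"
    using val inj
    by (intro finsum_cong' refl finsum_reindex) (auto intro!: finsum_closed)
  finally show ?thesis by (simp add: glue_def Q_def)
qed

section \<open>Compatibility with composition, linear structure and unit\<close>

text \<open>Here \<open>\<kappa>\<close> stands for the composite operation. Only its image under
  \<open>\<alpha>\<close> enters, so the argument takes place entirely among multilinear
  maps.\<close>

lemma matrix_action_pcomp:
  assumes V: "Module.module K V" and i: "i < m"
    and f: "\<alpha> m \<mu> \<in> multilinear_maps K V m" and g: "\<alpha> l \<nu> \<in> multilinear_maps K V l"
    and h: "\<alpha> (m + l - 1) \<kappa> = pcomp (End_operad K V) m i l (\<alpha> m \<mu>) (\<alpha> l \<nu>)"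
    and hc: "\<alpha> (m + l - 1) \<kappa> \<in> multilinear_maps K V (m + l - 1)"
  shows "matrix_action n V \<alpha> (m + l - 1) \<kappa> =
    pcomp (End_operad K (matrix_space n V)) m i l
      (matrix_action n V \<alpha> m \<mu>) (matrix_action n V \<alpha> l \<nu>)"
proof
  interpret Module.module K V by fact
  let ?W = "matrix_space n V" and ?h = "matrix_action n V \<alpha> (m + l - 1) \<kappa>"
  let ?f = "matrix_action n V \<alpha> m \<mu>" and ?g = "matrix_action n V \<alpha> l \<nu>"
  let ?fg = "pcomp (End_operad K ?W) m i l ?f ?g"
  fix Ms
  show "?h Ms = ?fg Ms"
  proof (cases "Ms \<in> tuples ?W (m + l - 1)")
    case Ms: True
    have len: "length Ms = m + l - 1" using Ms by (simp add: tuples_def)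
    define B where "B = ?g (take l (drop i Ms))"
    define Ns where "Ns = take i Ms @ B # drop (i + l) Ms"
    have mid: "take l (drop i Ms) \<in> tuples ?W l"
      using Ms i set_take_subset[of l "drop i Ms"] set_drop_subset[of i Ms]
      by (auto simp: tuples_def)
    have B: "B \<in> carrier ?W"
      unfolding B_def
      using multilinear_maps_closed[OF matrix_action_multilinear[where \<alpha> = \<alpha>, OF V g] mid] .
    have Ns: "Ns \<in> tuples ?W m"
      using Ms i B set_take_subset[of i Ms] set_drop_subset[of "i + l" Ms]
      by (auto simp: tuples_def Ns_def)
    have fg: "?fg Ms = ?f Ns"
      using Ms by (simp add: End_operad_def Ns_def B_def)
    have "?h Ms $$ (a, b) = ?f Ns $$ (a, b)" if ab: "a < n" "b < n" for a b
    proof -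
      have "?h Ms $$ (a, b) =
        (\<Oplus>\<^bsub>V\<^esub>ps\<in>index_paths n m a b. \<Oplus>\<^bsub>V\<^esub>qs\<in>index_paths n l (ps ! i) (ps ! (i + 1)).
          \<alpha> (m + l - 1) \<kappa> (path_entries Ms (take i ps @ qs @ drop (i + 2) ps)))"
        unfolding index_matrix_action[OF Ms ab]
        using multilinear_maps_closed[OF hc path_entries_in_tuples[OF Ms]]
        by (intro finsum_index_paths_insert[OF M.abelian_monoid_axioms i]) auto
      also have "\<dots> = (\<Oplus>\<^bsub>V\<^esub>ps\<in>index_paths n m a b. \<alpha> m \<mu> (path_entries Ns ps))"
      proof (intro M.finsum_cong' refl Pi_I)
        fix ps assume ps: "ps \<in> index_paths n m a b"
        let ?Q = "index_paths n l (ps ! i) (ps ! (i + 1))"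
        have es: "path_entries Ns ps \<in> tuples V m"
          using path_entries_in_tuples[OF Ns ps] .
        have hom: "mod_hom K V V (\<lambda>x. \<alpha> m \<mu> ((path_entries Ns ps)[i := x]))"
          using f es i V
          by (auto simp: multilinear_maps_def mod_hom_def mod_hom_axioms_def)
        \<comment> \<open>Position \<open>i\<close> of \<open>Ns\<close> holds \<open>B\<close>, so
          the argument in slot \<open>i\<close> is an entry of \<open>B\<close>, which is itself a
          sum over inner paths.\<close>
        have "path_entries Ns ps ! i = (\<Oplus>\<^bsub>V\<^esub>qs\<in>?Q. \<alpha> l \<nu> (path_entries (take l (drop i Ms)) qs))"
          using i Ns len index_paths_nth_less[OF ps, of i] index_paths_nth_less[OF ps, of "i + 1"]
          by (simp add: nth_path_entries tuples_def Ns_def B_def nth_append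
              index_matrix_action[OF mid] del: add_Suc_right)
        \<comment> \<open>Overwriting slot \<open>i\<close> by its own value exposes the linear map
          to which \<open>module_hom_finsum\<close> applies.\<close>
        then have "\<alpha> m \<mu> (path_entries Ns ps) = \<alpha> m \<mu> ((path_entries Ns ps)
            [i := \<Oplus>\<^bsub>V\<^esub>qs\<in>?Q. \<alpha> l \<nu> (path_entries (take l (drop i Ms)) qs)])"
          by (metis list_update_id)
        also have "\<dots> = (\<Oplus>\<^bsub>V\<^esub>qs\<in>?Q. \<alpha> m \<mu> ((path_entries Ns ps)
            [i := \<alpha> l \<nu> (path_entries (take l (drop i Ms)) qs)]))"
          using multilinear_maps_closed[OF g path_entries_in_tuples[OF mid]]
          by (intro module_hom_finsum[OF hom finite_index_paths]) auto
        also have "\<dots> = (\<Oplus>\<^bsub>V\<^esub>qs\<in>?Q.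
            \<alpha> (m + l - 1) \<kappa> (path_entries Ms (take i ps @ qs @ drop (i + 2) ps)))"
        proof (intro M.finsum_cong' refl Pi_I)
          fix qs assume qs: "qs \<in> ?Q"
          have "take i ps @ qs @ drop (i + 2) ps \<in> index_paths n (m + l - 1) a b"
            using index_paths_insert[OF i] ps qs by blast
          from path_entries_in_tuples[OF Ms this]
          have ks: "path_entries Ms (take i ps @ qs @ drop (i + 2) ps) \<in> tuples V (m + l - 1)" .
          show "\<alpha> m \<mu> ((path_entries Ns ps) [i := \<alpha> l \<nu> (path_entries (take l (drop i Ms)) qs)]) =
            \<alpha> (m + l - 1) \<kappa> (path_entries Ms (take i ps @ qs @ drop (i + 2) ps))"
            unfolding h Ns_def path_entries_insert[OF len i ps qs]
            using ks by (simp add: End_operad_def)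
          show "\<alpha> (m + l - 1) \<kappa> (path_entries Ms (take i ps @ qs @ drop (i + 2) ps)) \<in> carrier V"
            using multilinear_maps_closed[OF hc ks] .
        qed
        finally show "(\<Oplus>\<^bsub>V\<^esub>qs\<in>?Q.
            \<alpha> (m + l - 1) \<kappa> (path_entries Ms (take i ps @ qs @ drop (i + 2) ps))) =
          \<alpha> m \<mu> (path_entries Ns ps)" by simp
        show "\<alpha> m \<mu> (path_entries Ns ps) \<in> carrier V"
          using multilinear_maps_closed[OF f es] .
      qed
      also have "\<dots> = ?f Ns $$ (a, b)"
        by (rule index_matrix_action[OF Ns ab, symmetric])
      finally show ?thesis .
    qed
    then have "?h Ms = ?f Ns"
      using Ms Ns by (intro eq_matI) (auto simp: dim_matrix_action)
    then show ?thesis by (simp add: fg)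
  \<comment> \<open>Outside the tuples both functions are \<open>undefined\<close>.\<close>
  qed (simp add: End_operad_def matrix_action_def)
qed

text \<open>This is linearity in the operation, not in the matrices. The set of paths depends only
  on the arity, so the sums can be combined path by path.\<close>

lemma matrix_action_linear:
  assumes "Module.module K V" and hom: "\<alpha> m \<in> LinearCombinations.module_hom K U (multilinear_space K V m)"
  shows "matrix_action n V \<alpha> m \<in>
    LinearCombinations.module_hom K U (multilinear_space K (matrix_space n V) m)"
proof -
  interpret Module.module K V by fact
  let ?W = "matrix_space n V" and ?\<beta> = "matrix_action n V \<alpha> m"
  have \<alpha>: "\<alpha> m \<mu> \<in> multilinear_maps K V m" if "\<mu> \<in> carrier U" for \<mu>
    using LinearCombinations.module_hom_closed[OF hom] that by (auto simp: multilinear_space_def)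
  have val: "\<alpha> m \<mu> (path_entries Ms ks) \<in> carrier V"
    if "\<mu> \<in> carrier U" "Ms \<in> tuples ?W m" "ks \<in> index_paths n m i j" for \<mu> Ms ks i j
    using multilinear_maps_closed[OF \<alpha> path_entries_in_tuples] that by blast
  have add: "?\<beta> (\<mu> \<oplus>\<^bsub>U\<^esub> \<nu>) = ?\<beta> \<mu> \<oplus>\<^bsub>multilinear_space K ?W m\<^esub> ?\<beta> \<nu>"
    if \<mu>: "\<mu> \<in> carrier U" and \<nu>: "\<nu> \<in> carrier U" for \<mu> \<nu>
  proof
    fix Ms
    show "?\<beta> (\<mu> \<oplus>\<^bsub>U\<^esub> \<nu>) Ms = (?\<beta> \<mu> \<oplus>\<^bsub>multilinear_space K ?W m\<^esub> ?\<beta> \<nu>) Ms"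
    proof (cases "Ms \<in> tuples ?W m")
      case Ms: True
      have "?\<beta> (\<mu> \<oplus>\<^bsub>U\<^esub> \<nu>) Ms $$ (i, j) = ?\<beta> \<mu> Ms $$ (i, j) \<oplus>\<^bsub>V\<^esub> ?\<beta> \<nu> Ms $$ (i, j)"
        if ij: "i < n" "j < n" for i j
      proof -
        have "?\<beta> (\<mu> \<oplus>\<^bsub>U\<^esub> \<nu>) Ms $$ (i, j) = (\<Oplus>\<^bsub>V\<^esub>ks\<in>index_paths n m i j.
            \<alpha> m \<mu> (path_entries Ms ks) \<oplus>\<^bsub>V\<^esub> \<alpha> m \<nu> (path_entries Ms ks))"
          unfolding index_matrix_action[OF Ms ij]
          using val[OF \<mu> Ms] val[OF \<nu> Ms] path_entries_in_tuples[OF Ms]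
          by (intro M.finsum_cong')
            (auto simp: LinearCombinations.module_hom_add[OF hom \<mu> \<nu>] multilinear_space_def)
        then show ?thesis
          using val[OF \<mu> Ms] val[OF \<nu> Ms] by (simp add: index_matrix_action[OF Ms ij] Pi_def)
      qed
      then show ?thesis
        using Ms
        by (auto simp: multilinear_space_def matrix_space_simps dim_matrix_action intro!: eq_matI)
    qed (simp add: matrix_action_def multilinear_space_def)
  qed
  have smult: "?\<beta> (c \<odot>\<^bsub>U\<^esub> \<mu>) = c \<odot>\<^bsub>multilinear_space K ?W m\<^esub> ?\<beta> \<mu>"
    if c: "c \<in> carrier K" and \<mu>: "\<mu> \<in> carrier U" for c \<mu>
  proof
    fix Ms
    show "?\<beta> (c \<odot>\<^bsub>U\<^esub> \<mu>) Ms = (c \<odot>\<^bsub>multilinear_space K ?W m\<^esub> ?\<beta> \<mu>) Ms"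
    proof (cases "Ms \<in> tuples ?W m")
      case Ms: True
      have "?\<beta> (c \<odot>\<^bsub>U\<^esub> \<mu>) Ms $$ (i, j) = c \<odot>\<^bsub>V\<^esub> ?\<beta> \<mu> Ms $$ (i, j)"
        if ij: "i < n" "j < n" for i j
        unfolding index_matrix_action[OF Ms ij]
        using val[OF \<mu> Ms] path_entries_in_tuples[OF Ms] c
        by (subst finsum_smult)
          (auto simp: LinearCombinations.module_hom_smult[OF hom c \<mu>] multilinear_space_def
            intro!: M.finsum_cong')
      then show ?thesis
        using Ms
        by (auto simp: multilinear_space_def matrix_space_simps dim_matrix_action intro!: eq_matI)
    qed (simp add: matrix_action_def multilinear_space_def)
  qed
  show ?thesis
    using add smult matrix_action_multilinear[where \<alpha> = \<alpha>, OF assms(1) \<alpha>]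
    by (auto simp: LinearCombinations.module_hom_def) (auto simp: multilinear_space_def)
qed

text \<open>The only path with a single step from \<open>i\<close> to \<open>j\<close> is
  \<open>[i, j]\<close>, so the sum reduces to the entry of the given matrix there.\<close>

lemma matrix_action_id:
  assumes V: "abelian_monoid V" and id: "\<alpha> 1 \<mu> = op_id (End_operad K V)"
  shows "matrix_action n V \<alpha> 1 \<mu> = op_id (End_operad K (matrix_space n V))"
proof
  interpret abelian_monoid V by fact
  let ?W = "matrix_space n V"
  fix Ms
  show "matrix_action n V \<alpha> 1 \<mu> Ms = op_id (End_operad K ?W) Ms"
  proof (cases "Ms \<in> tuples ?W 1")
    case Ms: True
    then obtain X where X: "Ms = [X]" "X \<in> carrier ?W"
      by (auto simp: tuples_def length_Suc_conv)
    have "matrix_action n V \<alpha> 1 \<mu> Ms $$ (i, j) = X $$ (i, j)" if ij: "i < n" "j < n" for i j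
    proof -
      have "index_paths n 1 i j = {[i, j]}"
        using index_paths_Suc[OF ij, of 0] by (auto simp: image_def)
      then show ?thesis
        unfolding index_matrix_action[OF Ms ij]
        using X ij by (simp add: id[unfolded One_nat_def] End_operad_def tuples_def path_entries_def carrier_matrix_space)
    qed
    then show ?thesis
      using Ms X
      by (intro eq_matI)
        (auto simp: End_operad_def dim_matrix_action carrier_matrix_space)
  qed (simp add: matrix_action_def End_operad_def)
qed

section \<open>The algebra structure on matrices\<close>

lemma ns_operad_forget_sym:
  assumes "sym_operad K P"
  shows "ns_operad K (forget_sym P)"
  using sym_operad.axioms(1)[OF assms] by (simp add: ns_operad_def forget_sym_def)

theorem proposition4p1:
  fixes K :: "('k, 'r) ring_scheme"
    and P :: "('k, 'p) sym_operad"
    and A :: "('k, 'a, 'z) module_scheme"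
    and \<alpha>\<^sub>A :: "nat \<Rightarrow> 'p \<Rightarrow> 'a list \<Rightarrow> 'a"
    and n :: nat
  assumes "field K"
    and "sym_operad K P"
    and "operad_algebra K P A \<alpha>\<^sub>A"
    and "n \<ge> 1"
  shows "ns_operad_algebra K (forget_sym P) (matrix_space n A) (matrix_action n A \<alpha>\<^sub>A)"
proof -
  interpret P: sym_operad K P by fact
  \<comment> \<open>From here on the equivariance of \<open>\<alpha>\<^sub>A\<close> is
    dropped.\<close>
  have A: "vectorspace K A" and \<alpha>: "\<alpha>\<^sub>A \<in> ns_operad_hom K P (End_operad K A)"
    using assms(3) by (auto simp: operad_algebra_def sym_operad_hom_def)
  interpret A: vectorspace K A by fact
  have lin: "\<alpha>\<^sub>A m \<in> LinearCombinations.module_hom K (ops P m) (multilinear_space K A m)" for m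
    using \<alpha> by (auto simp: ns_operad_hom_def End_operad_def)
  have mult: "\<alpha>\<^sub>A m \<mu> \<in> multilinear_maps K A m" if "\<mu> \<in> carrier (ops P m)" for m \<mu>
    using LinearCombinations.module_hom_closed[OF lin] that by (auto simp: multilinear_space_def)
  \<comment> \<open>Closure under partial composition is contained in its linearity, here in the
    left argument.\<close>
  have closed: "pcomp P m i l \<mu> \<nu> \<in> carrier (ops P (m + l - 1))"
    if "i < m" "\<mu> \<in> carrier (ops P m)" "\<nu> \<in> carrier (ops P l)" for m i l \<mu> \<nu>
    using LinearCombinations.module_hom_closed[OF P.pcomp_linear_left[OF that(1,3)]] that(2) by auto
  \<comment> \<open>\<open>ns_operad_hom\<close> reads only the fields that
    \<open>forget_sym\<close> keeps, so the symmetric records can be used directly until the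
    end.\<close>
  have "matrix_action n A \<alpha>\<^sub>A \<in> ns_operad_hom K P (End_operad K (matrix_space n A))"
    unfolding ns_operad_hom_def
  proof (intro CollectI conjI allI ballI impI)
    fix m
    show "matrix_action n A \<alpha>\<^sub>A m \<in> LinearCombinations.module_hom K (ops P m)
        (ops (End_operad K (matrix_space n A)) m)"
      using matrix_action_linear[where \<alpha> = \<alpha>\<^sub>A and m = m, OF A.module_axioms lin] by (simp add: End_operad_def)
  next
    show "matrix_action n A \<alpha>\<^sub>A 1 (op_id P) = op_id (End_operad K (matrix_space n A))"
      using \<alpha> by (intro matrix_action_id A.M.abelian_monoid_axioms) (auto simp: ns_operad_hom_def)
  next
    fix m l i \<mu> \<nu>
    assume "i < m" "\<mu> \<in> carrier (ops P m)" "\<nu> \<in> carrier (ops P l)"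
    then show "matrix_action n A \<alpha>\<^sub>A (m + l - 1) (pcomp P m i l \<mu> \<nu>) =
      pcomp (End_operad K (matrix_space n A)) m i l
        (matrix_action n A \<alpha>\<^sub>A m \<mu>) (matrix_action n A \<alpha>\<^sub>A l \<nu>)"
      using \<alpha> by (intro matrix_action_pcomp[OF A.module_axioms] mult closed)
        (auto simp: ns_operad_hom_def)
  qed
  then show ?thesis
    using ns_operad_forget_sym[OF assms(2)] vectorspace_matrix_space[OF A]
    by (auto simp: ns_operad_algebra_def ns_operad_hom_def forget_sym_def)
qed

end
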